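(* For every integer $n > 59$ there exists a regular $K_4$-saturated graph with $n$ vertices, and there exists a regular $K_5$-saturated graph with $n$ vertices.
   Context: All graphs are finite and simple. For a graph $F$, a graph $G$ is $F$-saturated if $G$ contains no subgraph isomorphic to $F$, but adding any edge between two nonadjacent vertices of $G$ creates a subgraph isomorphic to $F$. A graph is regular if all its vertices have the same degree. $K_s$ denotes the complete graph on $s$ vertices. *)

theory Defs
  imports "Graph_Theory.Graph_Theory"
begin

text \<open>
  Finite simple graphs are the \<^term>\<open>pair_graph\<close>s of Graph_Theory: finite, loop-free
  digraphs with symmetric arc set \<open>parcs G \<subseteq> pverts G \<times> pverts G\<close>, an edge \<open>uv\<close> being represented by
  the two arcs \<open>(u,v)\<close> and \<open>(v,u)\<close>.
\<close>

definition complete_graph :: "nat \<Rightarrow> nat pair_pre_digraph" where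
  "complete_graph s = \<lparr> pverts = {..<s}, parcs = {(u, v). u < s \<and> v < s \<and> u \<noteq> v} \<rparr>"

definition contains_copy :: "'a pair_pre_digraph \<Rightarrow> 'b pair_pre_digraph \<Rightarrow> bool" where
  "contains_copy G F \<longleftrightarrow>
     (\<exists>H. pair_graph H \<and> subgraph (with_proj H) (with_proj G) \<and> digraph_iso (with_proj F) (with_proj H))"

definition add_edge :: "'a pair_pre_digraph \<Rightarrow> 'a \<Rightarrow> 'a \<Rightarrow> 'a pair_pre_digraph" where
  "add_edge G u v = G\<lparr>parcs := parcs G \<union> {(u, v), (v, u)}\<rparr>"

definition saturated :: "'b pair_pre_digraph \<Rightarrow> 'a pair_pre_digraph \<Rightarrow> bool" where
  "saturated F G \<longleftrightarrow>
     \<not> contains_copy G F \<and>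
     (\<forall>u\<in>pverts G. \<forall>v\<in>pverts G. u \<noteq> v \<and> (u, v) \<notin> parcs G \<longrightarrow> contains_copy (add_edge G u v) F)"

text \<open>By symmetry of \<open>parcs G\<close>, the out-degree is the number of neighbours.\<close>

definition regular_graph :: "'a pair_pre_digraph \<Rightarrow> bool" where
  "regular_graph G \<longleftrightarrow> (\<exists>d. \<forall>v\<in>pverts G. out_degree (with_proj G) v = d)"

lemma complete_digraph_complete_graph: "complete_digraph s (with_proj (complete_graph s))"
  unfolding complete_digraph_pair_def by (auto simp: complete_graph_def)

lemma (in pair_graph) pair_graph_add_edge:
  assumes "u \<in> pverts G" "v \<in> pverts G" "u \<noteq> v"
  shows "pair_graph (add_edge G u v)"
  using assms
  by unfold_locales
    (auto simp: add_edge_def symmetric_def sym_def wellformed' dest: no_loops arcs_symmetric)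

end

theory Submission
  imports Defs
begin

text \<open>
  The join of a \<open>K\<^bsub>r+1\<^esub>\<close>-saturated and a \<open>K\<^bsub>q+1\<^esub>\<close>-saturated graph is
  \<open>K\<^bsub>r+q+1\<^esub>\<close>-saturated, and it is regular if both graphs are regular with the same difference
  of order and degree. Joining a regular triangle-free graph of diameter two, with \<open>N\<close> vertices and
  degree \<open>d\<close>, to \<open>N - d\<close> isolated vertices settles \<open>K\<^sub>4\<close> for \<open>n = 2N - d\<close>; joining two such graphs,
  or one such graph twice to isolated vertices, settles \<open>K\<^sub>5\<close>. The triangle-free graphs are
  circulants on \<open>\<int>/N\<close> whose connection set \<open>S = -S\<close> is sum-free and complete, that is,
  \<open>S + S\<close> is disjoint from \<open>S\<close> and covers its complement. The sets
  \<open>S = \<plusminus>[a, 2a-1]\<close> and \<open>S = \<plusminus>[a, 2a-1] \<union> [x, N-x]\<close> give families with enough freedom in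
  \<open>N\<close> and \<open>d\<close> to reach all but a few values of \<open>n\<close>.
\<close>

section \<open>Saturation as a property of relations on an initial segment\<close>

definition clique :: "'a rel \<Rightarrow> 'a set \<Rightarrow> bool" where
  "clique E K \<longleftrightarrow> (\<forall>u\<in>K. \<forall>v\<in>K. u \<noteq> v \<longrightarrow> (u, v) \<in> E)"

text \<open>
  The index \<open>r\<close> is the clique number, so that this describes \<open>d\<close>-regular \<open>K\<^bsub>r+1\<^esub>\<close>-saturated
  graphs on \<open>N\<close> vertices. Existence of an \<open>r\<close>-clique is not implied by saturation if \<open>N < r\<close>, and
  the join needs it.
\<close>

definition regular_sat_rel :: "nat \<Rightarrow> nat \<Rightarrow> nat \<Rightarrow> nat rel \<Rightarrow> bool" where
  "regular_sat_rel r N d E \<longleftrightarrow> (E \<subseteq> {..<N} \<times> {..<N} \<and> sym E \<and> irrefl E \<and>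
     (\<forall>v<N. card (E `` {v}) = d) \<and>
     (\<exists>K\<subseteq>{..<N}. clique E K \<and> card K = r) \<and>
     (\<forall>K\<subseteq>{..<N}. clique E K \<longrightarrow> card K \<le> r) \<and>
     (\<forall>u<N. \<forall>v<N. u \<noteq> v \<longrightarrow> (u, v) \<notin> E \<longrightarrow>
       (\<exists>W\<subseteq>{..<N} - {u, v}. Suc (card W) = r \<and> clique E (insert u W) \<and> clique E (insert v W))))"

definition regular_sat :: "nat \<Rightarrow> nat \<Rightarrow> nat \<Rightarrow> bool" where
  "regular_sat r N d \<longleftrightarrow> (\<exists>E. regular_sat_rel r N d E)"

lemma regular_sat_relD:
  assumes "regular_sat_rel r N d E"
  shows "E \<subseteq> {..<N} \<times> {..<N}" "sym E" "irrefl E"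
    and "v < N \<Longrightarrow> card (E `` {v}) = d"
    and "\<exists>K\<subseteq>{..<N}. clique E K \<and> card K = r"
    and "K \<subseteq> {..<N} \<Longrightarrow> clique E K \<Longrightarrow> card K \<le> r"
    and "u < N \<Longrightarrow> v < N \<Longrightarrow> u \<noteq> v \<Longrightarrow> (u, v) \<notin> E \<Longrightarrow>
       \<exists>W\<subseteq>{..<N} - {u, v}. Suc (card W) = r \<and> clique E (insert u W) \<and> clique E (insert v W)"
  using assms unfolding regular_sat_rel_def by simp_all

section \<open>From cliques to copies of complete graphs\<close>

lemma contains_copy_complete_graphD:
  assumes "contains_copy G (complete_graph s)"
  obtains K where "K \<subseteq> pverts G" "clique (parcs G) K" "card K = s"
proof -
  obtain H f where H: "subgraph (with_proj H) (with_proj G)"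
    and f: "pre_digraph.digraph_isomorphism (with_proj (complete_graph s)) f"
    and Hf: "with_proj H = app_iso f (with_proj (complete_graph s))"
    using assms unfolding contains_copy_def digraph_iso_def by blast
  let ?g = "iso_verts f"
  have inj: "inj_on ?g {..<s}"
    using f by (simp add: pre_digraph.digraph_isomorphism_def complete_graph_def)
  have V: "pverts H = ?g ` {..<s}"
    using arg_cong[OF Hf, of verts] by (simp add: complete_graph_def)
  have A: "parcs H = iso_arcs f ` parcs (complete_graph s)"
    using arg_cong[OF Hf, of arcs] by simp
  \<comment> \<open>\<open>H\<close> has the projections as its tail and head maps, which forces
    \<open>iso_tail f\<close> and \<open>iso_head f\<close> to be projections. The isomorphism must
    therefore send the arc \<open>(i, j)\<close> to \<open>(?g i, ?g j)\<close>.\<close>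
  have hd: "snd = iso_head f" and tl: "fst = iso_tail f"
    using arg_cong[OF Hf, of head] arg_cong[OF Hf, of tail] by simp_all
  have arc: "(?g i, ?g j) \<in> parcs H" if "i < s" "j < s" "i \<noteq> j" for i j
  proof -
    have mem: "(i, j) \<in> parcs (complete_graph s)"
      using that by (simp add: complete_graph_def)
    then have "?g i = fst (iso_arcs f (i, j))" "?g j = snd (iso_arcs f (i, j))"
      using f hd tl by (auto simp: pre_digraph.digraph_isomorphism_def)
    then show ?thesis using mem A by force
  qed
  show thesis
  proof
    show "?g ` {..<s} \<subseteq> pverts G" using H V by (auto simp: subgraph_def)
    show "clique (parcs G) (?g ` {..<s})"
      using H arc unfolding clique_def subgraph_def by fastforce
    show "card (?g ` {..<s}) = s" using inj by (simp add: card_image)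
  qed
qed

lemma contains_copy_complete_graphI:
  assumes G: "pair_graph G" and K: "K \<subseteq> pverts G" "clique (parcs G) K" "card K = s"
  shows "contains_copy G (complete_graph s)"
proof -
  interpret G: pair_graph G by fact
  have finK: "finite K" using K(1) G.pair_finite_verts finite_subset by blast
  obtain g where g: "bij_betw g {..<s} K"
    using finK K(3) by (metis atLeast0LessThan ex_bij_betw_nat_finite)
  define H where "H = \<lparr> pverts = K, parcs = {(u, v). u \<in> K \<and> v \<in> K \<and> u \<noteq> v} \<rparr>"
  have "finite {(u, v). u \<in> K \<and> v \<in> K \<and> u \<noteq> v}"
    by (rule finite_subset[of _ "K \<times> K"]) (use finK in auto)
  then have H: "pair_graph H"
    using finK by unfold_locales (auto simp: H_def symmetric_def sym_def)
  interpret H: pair_graph H by fact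
  have wfC: "pair_wf_digraph (complete_graph s)"
    by unfold_locales (auto simp: complete_graph_def)
  have sub: "subgraph (with_proj H) (with_proj G)"
    unfolding subgraph_def using K H.wf_digraph_axioms G.wf_digraph_axioms
    by (auto simp: H_def clique_def)
  let ?f = "\<lparr> iso_verts = g, iso_arcs = map_prod g g, iso_head = snd, iso_tail = fst \<rparr>"
  have inj: "inj_on g {..<s}" and img: "g ` {..<s} = K"
    using g by (auto simp: bij_betw_def)
  have "inj_on (map_prod g g) (parcs (complete_graph s))"
    by (rule inj_on_subset[OF map_prod_inj_on[OF inj inj]]) (auto simp: complete_graph_def)
  then have "pre_digraph.digraph_isomorphism (with_proj (complete_graph s)) ?f"
    using inj wfC
    by (auto simp: pre_digraph.digraph_isomorphism_def wf_digraph_wp_iff)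
       (simp add: complete_graph_def)
  moreover have "with_proj H = app_iso ?f (with_proj (complete_graph s))"
  proof -
    have "map_prod g g ` {(u, v). u < s \<and> v < s \<and> u \<noteq> v} = {(u, v). u \<in> K \<and> v \<in> K \<and> u \<noteq> v}"
    proof
      show "map_prod g g ` {(u, v). u < s \<and> v < s \<and> u \<noteq> v} \<subseteq> {(u, v). u \<in> K \<and> v \<in> K \<and> u \<noteq> v}"
        using inj img by (auto dest: inj_onD)
      show "{(u, v). u \<in> K \<and> v \<in> K \<and> u \<noteq> v} \<subseteq> map_prod g g ` {(u, v). u < s \<and> v < s \<and> u \<noteq> v}"
        unfolding img[symmetric] by force
    qed
    then show ?thesis using img
      by (simp add: with_proj_def app_iso_def H_def complete_graph_def)
  qed
  ultimately show ?thesis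
    unfolding contains_copy_def digraph_iso_def using H sub by blast
qed

lemma regular_sat_imp_saturated_graph:
  assumes "regular_sat r n d"
  shows "\<exists>G :: nat pair_pre_digraph. pair_graph G \<and> card (pverts G) = n \<and> regular_graph G \<and>
           saturated (complete_graph (Suc r)) G"
proof -
  obtain E where rel: "regular_sat_rel r n d E"
    using assms unfolding regular_sat_def by blast
  note E = regular_sat_relD(1-3)[OF rel] and deg = regular_sat_relD(4)[OF rel]
    and max = regular_sat_relD(6)[OF rel] and sat = regular_sat_relD(7)[OF rel]
  define G where "G = \<lparr> pverts = {..<n}, parcs = E \<rparr>"
  have "finite E" using E(1) by (rule finite_subset) simp
  then have pg: "pair_graph G"
    using E by unfold_locales (auto simp: G_def symmetric_def irrefl_def)
  interpret G: pair_graph G by fact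
  have "out_degree (with_proj G) v = d" if "v \<in> pverts G" for v
  proof -
    have "out_arcs (with_proj G) v = Pair v ` (E `` {v})"
      by (auto simp: out_arcs_def G_def)
    then show ?thesis
      using deg that by (simp add: out_degree_def card_image inj_on_def G_def)
  qed
  then have "regular_graph G" unfolding regular_graph_def by blast
  moreover have "saturated (complete_graph (Suc r)) G"
    unfolding saturated_def
  proof (intro conjI ballI impI)
    show "\<not> contains_copy G (complete_graph (Suc r))"
    proof
      assume "contains_copy G (complete_graph (Suc r))"
      then obtain K where "K \<subseteq> pverts G" "clique (parcs G) K" "card K = Suc r"
        by (rule contains_copy_complete_graphD)
      then show False using max[of K] by (simp add: G_def)
    qed
  next
    fix u v assume uv: "u \<in> pverts G" "v \<in> pverts G" "u \<noteq> v \<and> (u, v) \<notin> parcs G"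
    \<comment> \<open>The new edge completes \<open>W\<close> together with both endpoints to a
      clique of size \<open>r + 1\<close>.\<close>
    then obtain W where W: "W \<subseteq> {..<n} - {u, v}" "Suc (card W) = r"
        "clique E (insert u W)" "clique E (insert v W)"
      using sat[of u v] by (auto simp: G_def)
    have "finite W" using W(1) finite_subset by blast
    then have "card (insert u (insert v W)) = Suc r"
      using W(1,2) uv(3) by (subst card_insert_disjoint; auto)+
    moreover have "clique (parcs (add_edge G u v)) (insert u (insert v W))"
      using W(3,4) by (auto simp: clique_def add_edge_def G_def)
    moreover have "insert u (insert v W) \<subseteq> pverts (add_edge G u v)"
      using W(1) uv by (auto simp: add_edge_def G_def)
    ultimately show "contains_copy (add_edge G u v) (complete_graph (Suc r))"
      using contains_copy_complete_graphI G.pair_graph_add_edge uv by blast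
  qed
  ultimately show ?thesis using pg by (auto simp: G_def)
qed

section \<open>Edgeless graphs and joins\<close>

lemma regular_sat_empty:
  assumes "0 < c"
  shows "regular_sat 1 c 0"
  unfolding regular_sat_def regular_sat_rel_def
proof (rule exI[of _ "{}"], intro conjI allI impI)
  show "\<exists>K\<subseteq>{..<c}. clique {} K \<and> card K = 1"
    using assms by (intro exI[of _ "{0}"]) (auto simp: clique_def)
  fix K :: "nat set" assume "clique {} K"
  \<comment> \<open>An infinite set has \<open>card\<close> equal to 0, so the bound holds in that
    case as well.\<close>
  then show "card K \<le> 1"
    by (cases "finite K") (auto simp: clique_def card_le_Suc0_iff_eq)
next
  fix u v
  show "\<exists>W\<subseteq>{..<c} - {u, v}. Suc (card W) = 1 \<and> clique {} (insert u W) \<and> clique {} (insert v W)"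
    by (intro exI[of _ "{}"]) (auto simp: clique_def)
qed (auto simp: sym_def irrefl_def)

text \<open>Shifting the second graph by \<open>N\<close> makes the vertex sets disjoint and keeps
  their union an initial segment, the form that \<open>regular_sat_rel\<close> requires.\<close>

definition join :: "nat \<Rightarrow> nat rel \<Rightarrow> nat \<Rightarrow> nat rel \<Rightarrow> nat rel" where
  "join N E M F = E \<union> map_prod ((+) N) ((+) N) ` F \<union> {..<N} \<times> {N..<N + M} \<union> {N..<N + M} \<times> {..<N}"

lemma join_low: "u < N \<Longrightarrow> v < N \<Longrightarrow> (u, v) \<in> join N E M F \<longleftrightarrow> (u, v) \<in> E"
  by (auto simp: join_def)

lemma join_high:
  assumes "E \<subseteq> {..<N} \<times> {..<N}"
  shows "(N + u, N + v) \<in> join N E M F \<longleftrightarrow> (u, v) \<in> F"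
  using assms by (auto simp: join_def)

lemma clique_join:
  assumes "A \<subseteq> {..<N}" "clique E A" "B \<subseteq> {..<M}" "clique F B"
  shows "clique (join N E M F) (A \<union> (+) N ` B)"
  unfolding clique_def
proof (intro ballI impI)
  fix u v assume uv: "u \<in> A \<union> (+) N ` B" "v \<in> A \<union> (+) N ` B" "u \<noteq> v"
  show "(u, v) \<in> join N E M F"
  proof (cases "u \<in> A"; cases "v \<in> A")
    assume "u \<in> A" "v \<in> A"
    then show ?thesis using assms(2) uv(3) by (auto simp: clique_def join_def)
  next
    assume "u \<notin> A" "v \<notin> A"
    then obtain u' v' where "u = N + u'" "v = N + v'" "u' \<in> B" "v' \<in> B" using uv by blast
    then show ?thesis using assms(4) uv(3) by (auto simp: clique_def join_def)
  qed (use uv assms(1,3) in \<open>auto simp: join_def\<close>)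
qed

lemma card_join:
  assumes "A \<subseteq> {..<N}" "B \<subseteq> {..<M}"
  shows "card (A \<union> (+) N ` B) = card A + card (B :: nat set)"
proof -
  have "finite A" "finite B" using assms finite_subset by blast+
  then show ?thesis
    using assms by (subst card_Un_disjoint) (auto simp: card_image)
qed

text \<open>A clique of the join is a clique on each side, so clique numbers add. Vertices of the
  two sides get degrees \<open>d + M\<close> and \<open>N + e\<close>, whence the equation.
  Nonadjacent vertices lie on the same side; their witness there is enlarged by a maximum clique of
  the other side.\<close>

lemma regular_sat_join:
  assumes "regular_sat r N d" "regular_sat q M e" "d + M = N + e"
  shows "regular_sat (r + q) (N + M) (d + M)"
proof -
  obtain E where relE: "regular_sat_rel r N d E"
    using assms(1) unfolding regular_sat_def by blast
  note E = regular_sat_relD(1-3)[OF relE] and degE = regular_sat_relD(4)[OF relE]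
    and exE = regular_sat_relD(5)[OF relE] and maxE = regular_sat_relD(6)[OF relE]
    and satE = regular_sat_relD(7)[OF relE]
  obtain F where relF: "regular_sat_rel q M e F"
    using assms(2) unfolding regular_sat_def by blast
  note F = regular_sat_relD(1-3)[OF relF] and degF = regular_sat_relD(4)[OF relF]
    and exF = regular_sat_relD(5)[OF relF] and maxF = regular_sat_relD(6)[OF relF]
    and satF = regular_sat_relD(7)[OF relF]
  obtain A where A: "A \<subseteq> {..<N}" "clique E A" "card A = r" using exE by blast
  obtain B where B: "B \<subseteq> {..<M}" "clique F B" "card B = q" using exF by blast
  let ?J = "join N E M F"
  have split: "K = (K \<inter> {..<N}) \<union> (+) N ` {x. x < M \<and> N + x \<in> K}" if "K \<subseteq> {..<N + M}" for K
  proof -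
    have "x \<in> (+) N ` {x. x < M \<and> N + x \<in> K}" if "x \<in> K" "\<not> x < N" for x
      using that \<open>K \<subseteq> {..<N + M}\<close> by (intro image_eqI[of _ _ "x - N"]) auto
    then show ?thesis by auto
  qed
  show ?thesis
    unfolding regular_sat_def regular_sat_rel_def
  proof (rule exI[of _ ?J], intro conjI allI impI)
    show "?J \<subseteq> {..<N + M} \<times> {..<N + M}"
      using E(1) F(1) by (fastforce simp: join_def)
    show "sym ?J" using E(2) F(2) by (auto simp: join_def sym_def)
    show "irrefl ?J" using E(3) F(3) by (auto simp: join_def irrefl_def)
  next
    fix v assume v: "v < N + M"
    show "card (?J `` {v}) = d + M"
    proof (cases "v < N")
      case True
      then have "?J `` {v} = E `` {v} \<union> {N..<N + M}"
        by (auto simp: join_def)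
      also have "{N..<N + M} = (+) N ` {..<M}"
        by (simp add: lessThan_atLeast0 add.commute)
      finally have "?J `` {v} = E `` {v} \<union> (+) N ` {..<M}" .
      then show ?thesis
        using card_join[of "E `` {v}" N "{..<M}" M] E(1) degE[OF True] by auto
    next
      case False
      then obtain v' where v': "v = N + v'" "v' < M"
        using v by (metis le_add_diff_inverse linorder_not_le nat_add_left_cancel_less)
      then have "(v, w) \<notin> E" for w using E(1) by auto
      then have "?J `` {v} = {..<N} \<union> (+) N ` (F `` {v - N})"
        using v' by (auto simp: join_def)
      moreover have "card ({..<N} \<union> (+) N ` (F `` {v - N})) = N + e"
        using card_join[of "{..<N}" N "F `` {v - N}" M] F(1) degF[of "v - N"] False v by auto
      ultimately show ?thesis using assms(3) by simp
    qed
  next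
    show "\<exists>K\<subseteq>{..<N + M}. clique ?J K \<and> card K = r + q"
      using A B clique_join[OF A(1,2) B(1,2)] card_join[OF A(1) B(1)]
      by (intro exI[of _ "A \<union> (+) N ` B"]) auto
  next
    fix K assume K: "K \<subseteq> {..<N + M}" "clique ?J K"
    have "clique E (K \<inter> {..<N})"
      using K(2) join_low unfolding clique_def by blast
    moreover have "clique F {x. x < M \<and> N + x \<in> K}"
      unfolding clique_def
    proof (intro ballI impI)
      fix x y assume "x \<in> {x. x < M \<and> N + x \<in> K}" "y \<in> {x. x < M \<and> N + x \<in> K}" "x \<noteq> y"
      then have "(N + x, N + y) \<in> ?J" using K(2) by (simp add: clique_def)
      then show "(x, y) \<in> F" by (simp add: join_high[OF E(1)])
    qed
    ultimately have "card (K \<inter> {..<N}) \<le> r" "card {x. x < M \<and> N + x \<in> K} \<le> q"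
      using maxE[of "K \<inter> {..<N}"] maxF[of "{x. x < M \<and> N + x \<in> K}"] by auto
    moreover have "card K = card (K \<inter> {..<N}) + card {x. x < M \<and> N + x \<in> K}"
      by (rule trans[OF arg_cong[OF split[OF K(1)], of card] card_join]) auto
    ultimately show "card K \<le> r + q" by linarith
  next
    fix u v assume uv: "u < N + M" "v < N + M" "u \<noteq> v" "(u, v) \<notin> ?J"
    then consider (low) "u < N" "v < N" "(u, v) \<notin> E"
      | (high) u' v' where "u = N + u'" "v = N + v'" "u' < M" "v' < M" "u' \<noteq> v'" "(u', v') \<notin> F"
    proof (cases "u < N"; cases "v < N")
      assume "\<not> u < N" "\<not> v < N"
      then obtain u' v' where "u = N + u'" "v = N + v'"
        by (metis le_add_diff_inverse linorder_not_le)
      then show thesis using uv join_high[OF E(1)] by (intro high[of u' v']) auto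
    qed (use uv in \<open>auto simp: join_def\<close>)
    then show "\<exists>W\<subseteq>{..<N + M} - {u, v}. Suc (card W) = r + q \<and>
        clique ?J (insert u W) \<and> clique ?J (insert v W)"
    proof cases
      case low
      then obtain W where W: "W \<subseteq> {..<N} - {u, v}" "Suc (card W) = r"
        "clique E (insert u W)" "clique E (insert v W)"
        using satE uv(3) by blast
      then have "W \<subseteq> {..<N}" by blast
      show ?thesis
      proof (intro exI[of _ "W \<union> (+) N ` B"] conjI)
        show "W \<union> (+) N ` B \<subseteq> {..<N + M} - {u, v}" using W(1) B(1) low by auto
        show "Suc (card (W \<union> (+) N ` B)) = r + q"
          using card_join[OF \<open>W \<subseteq> {..<N}\<close> B(1)] W(2) B(3) by simp
        show "clique ?J (insert u (W \<union> (+) N ` B))"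
          using clique_join[of "insert u W" N E B M F] \<open>W \<subseteq> {..<N}\<close> W(3,4) B low by simp
        show "clique ?J (insert v (W \<union> (+) N ` B))"
          using clique_join[of "insert v W" N E B M F] \<open>W \<subseteq> {..<N}\<close> W(3,4) B low by simp
      qed
    next
      case (high u' v')
      then obtain W where W: "W \<subseteq> {..<M} - {u', v'}" "Suc (card W) = q"
        "clique F (insert u' W)" "clique F (insert v' W)"
        using satF by blast
      then have "W \<subseteq> {..<M}" by blast
      show ?thesis
      proof (intro exI[of _ "A \<union> (+) N ` W"] conjI)
        show "A \<union> (+) N ` W \<subseteq> {..<N + M} - {u, v}" using W(1) A(1) high by auto
        show "Suc (card (A \<union> (+) N ` W)) = r + q"
          using card_join[OF A(1) \<open>W \<subseteq> {..<M}\<close>] W(2) A(3) by simp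
        show "clique ?J (insert u (A \<union> (+) N ` W))"
          using clique_join[of A N E "insert u' W" M F] \<open>W \<subseteq> {..<M}\<close> W(3,4) A high by simp
        show "clique ?J (insert v (A \<union> (+) N ` W))"
          using clique_join[of A N E "insert v' W" M F] \<open>W \<subseteq> {..<M}\<close> W(3,4) A high by simp
      qed
    qed
  qed
qed

section \<open>Circulant triangle-free graphs of diameter two\<close>

text \<open>
  Residues are represented in \<open>{1..<N}\<close> and sums are not reduced modulo \<open>N\<close>: since \<open>S = -S\<close>, a
  relation \<open>s + s' = t + N\<close> is the same as \<open>s = t + (N - s')\<close>. For the same reason completeness
  only has to be checked up to \<open>N/2\<close>.
\<close>

lemma regular_sat_circulant:
  fixes S :: "nat set"
  assumes S: "S \<subseteq> {1..<N}" "S \<noteq> {}"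
    and neg: "\<forall>s\<in>S. N - s \<in> S"
    and sum_free: "\<forall>s\<in>S. \<forall>t\<in>S. s + t \<notin> S"
    and complete: "\<forall>t\<in>{1..N div 2} - S. \<exists>s\<in>S. t + s \<in> S \<or> (s < t \<and> t - s \<in> S)"
  shows "regular_sat 2 N (card S)"
proof -
  \<comment> \<open>Subtraction is truncated and \<open>0\<close> is not in \<open>S\<close>, so the
    disjunction says that the absolute difference of \<open>u\<close> and \<open>v\<close> lies in
    \<open>S\<close>.\<close>
  define E where "E = {(u, v). u < N \<and> v < N \<and> (v - u \<in> S \<or> u - v \<in> S)}"
  have S0: "0 \<notin> S" using S by auto
  have lt: "s < N" if "s \<in> S" for s using S that by auto
  have common: "\<exists>w<N. (u, w) \<in> E \<and> (v, w) \<in> E" if uv: "u < v" "v < N" "(u, v) \<notin> E" for u v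
  proof -
    define t where "t = v - u"
    have t: "0 < t" "t < N" "t \<notin> S" "N - t \<notin> S" "v = u + t"
      using uv bspec[OF neg, of "N - t"] by (auto simp: t_def E_def)
    have "\<exists>s\<in>S. t + s \<in> S \<or> (s < t \<and> t - s \<in> S)"
    proof (cases "2 * t \<le> N")
      \<comment> \<open>Completeness is applied to \<open>N - t\<close> and reflected back: negation
        turns a sum witness for \<open>N - t\<close> into a difference witness for \<open>t\<close>,
        and conversely.\<close>
      case False
      then have "2 * (N - t) \<le> N" by linarith
      then obtain s where s: "s \<in> S" "N - t + s \<in> S \<or> (s < N - t \<and> N - t - s \<in> S)"
        using bspec[OF complete, of "N - t"] t by force
      from s(2) show ?thesis
      proof
        assume "N - t + s \<in> S"
        then have "s < t" "t - s \<in> S" using bspec[OF neg, of "N - t + s"] lt[of "N - t + s"] t by auto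
        then show ?thesis using s(1) by blast
      next
        assume "s < N - t \<and> N - t - s \<in> S"
        then have "t + s \<in> S" using bspec[OF neg, of "N - t - s"] t by (auto simp: algebra_simps)
        then show ?thesis using s(1) by blast
      qed
    qed (use bspec[OF complete, of t] t in auto)
    then obtain s where s: "s \<in> S" "t + s \<in> S \<or> (s < t \<and> t - s \<in> S)" by blast
    from s(2) show ?thesis
    proof
      assume ts: "t + s \<in> S"
      show ?thesis
      proof (cases "v + s < N")
        case True
        then show ?thesis using ts s(1) uv t
          by (intro exI[of _ "v + s"]) (auto simp: E_def add.assoc)
      next
        case False
        \<comment> \<open>The common neighbour is \<open>v + s\<close> reduced modulo
          \<open>N\<close>.\<close>
        let ?w = "v + s - N"
        have "u - ?w = N - (t + s)" "v - ?w = N - s" "?w < N"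
          using False t lt[OF ts] lt[OF s(1)] uv by auto
        then show ?thesis using bspec[OF neg ts] bspec[OF neg s(1)] uv
          by (intro exI[of _ ?w]) (auto simp: E_def)
      qed
    next
      assume "s < t \<and> t - s \<in> S"
      then show ?thesis using s(1) uv t
        by (intro exI[of _ "u + s"]) (auto simp: E_def)
    qed
  qed
  have deg: "card (E `` {u}) = card S" if u: "u < N" for u
  proof (rule bij_betw_same_card[symmetric])
    \<comment> \<open>The neighbourhood of \<open>u\<close> is the translate of \<open>S\<close> by
      \<open>u\<close> modulo \<open>N\<close>.\<close>
    show "bij_betw (\<lambda>s. if u + s < N then u + s else u + s - N) S (E `` {u})"
    proof (rule bij_betwI[where g = "\<lambda>v. if u < v then v - u else N + v - u"])
      show "(\<lambda>s. if u + s < N then u + s else u + s - N) \<in> S \<rightarrow> E `` {u}"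
      proof
        fix s assume s: "s \<in> S"
        show "(if u + s < N then u + s else u + s - N) \<in> E `` {u}"
        proof (cases "u + s < N")
          case True
          then show ?thesis using s u by (auto simp: E_def)
        next
          case False
          then have "u - (u + s - N) = N - s" "u + s - N < N" using lt[OF s] u by auto
          then show ?thesis using False bspec[OF neg s] u by (auto simp: E_def)
        qed
      qed
      show "(\<lambda>v. if u < v then v - u else N + v - u) \<in> E `` {u} \<rightarrow> S"
      proof
        fix v assume "v \<in> E `` {u}"
        then have v: "v < N" "v - u \<in> S \<or> u - v \<in> S" by (auto simp: E_def)
        show "(if u < v then v - u else N + v - u) \<in> S"
        proof (cases "u < v")
          case True
          then show ?thesis using v S0 by auto
        next
          case False
          then have "u - v \<in> S" "N - (u - v) = N + v - u" using v S0 u by auto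
          then show ?thesis using False bspec[OF neg, of "u - v"] by auto
        qed
      qed
    next
      fix s assume "s \<in> S"
      then show "(if u < (if u + s < N then u + s else u + s - N)
          then (if u + s < N then u + s else u + s - N) - u
          else N + (if u + s < N then u + s else u + s - N) - u) = s"
        using lt[of s] S0 u by (cases "s = 0") auto
    next
      fix v assume "v \<in> E `` {u}"
      then show "(if u + (if u < v then v - u else N + v - u) < N
          then u + (if u < v then v - u else N + v - u)
          else u + (if u < v then v - u else N + v - u) - N) = v"
        using u S0 by (auto simp: E_def)
    qed
  qed
  \<comment> \<open>With the vertices in increasing order the differences add up without wrapping
    around, so sum-freeness over the naturals suffices.\<close>
  have no_triangle: False if "u < v" "v < w" "(u, v) \<in> E" "(v, w) \<in> E" "(u, w) \<in> E" for u v w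
  proof -
    have "v - u \<in> S" "w - v \<in> S" "w - u \<in> S" using that S0 by (auto simp: E_def)
    moreover have "(v - u) + (w - v) = w - u" using that by simp
    ultimately show False using sum_free by metis
  qed
  have symE: "sym E" by (auto simp: sym_def E_def)
  obtain s0 where s0: "s0 \<in> S" using S by blast
  have "regular_sat_rel 2 N (card S) E"
    unfolding regular_sat_rel_def
  proof (intro conjI allI impI)
    show "E \<subseteq> {..<N} \<times> {..<N}" "sym E" "irrefl E"
      using symE S0 by (auto simp: E_def irrefl_def)
  next
    fix v assume "v < N"
    then show "card (E `` {v}) = card S" by (rule deg)
  next
    have "s0 \<noteq> 0" using s0 S0 by metis
    then have "(0, s0) \<in> E" "(s0, 0) \<in> E" using s0 lt[OF s0] by (auto simp: E_def)
    then show "\<exists>K\<subseteq>{..<N}. clique E K \<and> card K = 2"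
      using lt[OF s0] by (intro exI[of _ "{0, s0}"]) (use \<open>s0 \<noteq> 0\<close> in \<open>auto simp: clique_def\<close>)
  next
    fix K assume K: "K \<subseteq> {..<N}" "clique E K"
    show "card K \<le> 2"
    proof (rule ccontr)
      assume "\<not> card K \<le> 2"
      then obtain T where T: "T \<subseteq> K" "card T = 3"
        using obtain_subset_with_card_n[of 3 K] by auto
      then obtain x y z where xyz: "T = {x, y, z}" "x \<noteq> y" "y \<noteq> z" "x \<noteq> z"
        by (auto simp: card_3_iff)
      have "\<exists>a b c. a \<in> T \<and> b \<in> T \<and> c \<in> T \<and> a < b \<and> b < c"
        using xyz by (metis insertCI linorder_neqE_nat)
      then obtain a b c where "a \<in> K" "b \<in> K" "c \<in> K" "a < b" "b < c" using T by blast
      then show False using no_triangle[of a b c] K(2) by (auto simp: clique_def)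
    qed
  next
    fix u v assume uv: "u < N" "v < N" "u \<noteq> v" "(u, v) \<notin> E"
    have "\<exists>w<N. (u, w) \<in> E \<and> (v, w) \<in> E"
      using common[of u v] common[of v u] uv symE by (metis linorder_neqE_nat symD)
    then obtain w where w: "w < N" "(u, w) \<in> E" "(v, w) \<in> E" by blast
    then have "w \<noteq> u" "w \<noteq> v" using S0 by (auto simp: E_def)
    then show "\<exists>W\<subseteq>{..<N} - {u, v}. Suc (card W) = 2 \<and> clique E (insert u W) \<and> clique E (insert v W)"
      using w symE by (intro exI[of _ "{w}"]) (auto simp: clique_def dest: symD)
  qed
  then show ?thesis unfolding regular_sat_def by blast
qed

section \<open>Two families of connection sets\<close>

text \<open>Differences inside \<open>{a..<2 * a}\<close> fill the numbers below \<open>a\<close>,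
  and sums fill \<open>2 * a\<close> to \<open>4 * a - 2\<close>. The bound
  \<open>6 * a \<le> N + 2\<close> keeps these sums below the reflected interval;
  \<open>N + 3 \<le> 8 * a\<close> makes them reach \<open>N div 2\<close>.\<close>

lemma regular_sat_two_intervals:
  assumes "1 \<le> a" "6 * a \<le> N + 2" "N + 3 \<le> 8 * a"
  shows "regular_sat 2 N (2 * a)"
proof -
  define S where "S = {a..<2 * a} \<union> {N + 1 - 2 * a..<N + 1 - a}"
  have mem: "s \<in> S \<longleftrightarrow> (a \<le> s \<and> s < 2 * a) \<or> (N < s + 2 * a \<and> s + a \<le> N)" for s
    using assms by (auto simp: S_def)
  have "card S = 2 * a"
    unfolding S_def using assms by (subst card_Un_disjoint) auto
  moreover have "regular_sat 2 N (card S)"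
  proof (rule regular_sat_circulant)
    show "\<forall>t\<in>{1..N div 2} - S. \<exists>s\<in>S. t + s \<in> S \<or> (s < t \<and> t - s \<in> S)"
    proof
      fix t assume "t \<in> {1..N div 2} - S"
      then have t: "0 < t" "2 * t \<le> N" "t \<notin> S" by auto
      have "t < a \<or> 2 * a \<le> t" "t < 4 * a - 1"
        using t assms unfolding mem by linarith+
      then consider "t < a" | "2 * a \<le> t" "t < 3 * a" | "3 * a \<le> t" "t < 4 * a - 1" by linarith
      then show "\<exists>s\<in>S. t + s \<in> S \<or> (s < t \<and> t - s \<in> S)"
      proof cases
        case 1
        then have "a \<in> S" "t + a \<in> S" using t assms unfolding mem by linarith+
        then show ?thesis by blast
      next
        case 2
        then have "a \<in> S" "a < t" "t - a \<in> S" using assms unfolding mem by linarith+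
        then show ?thesis by blast
      next
        case 3
        then have "2 * a - 1 \<in> S" "2 * a - 1 < t" "t - (2 * a - 1) \<in> S"
          using assms unfolding mem by linarith+
        then show ?thesis by blast
      qed
    qed
  next
    show "\<forall>s\<in>S. \<forall>t\<in>S. s + t \<notin> S"
    proof (intro ballI)
      fix s t assume "s \<in> S" "t \<in> S"
      then show "s + t \<notin> S" using assms unfolding mem by linarith
    qed
  next
    show "\<forall>s\<in>S. N - s \<in> S"
    proof
      fix s assume "s \<in> S"
      then show "N - s \<in> S" using assms unfolding mem by linarith
    qed
  next
    show "S \<subseteq> {1..<N}" using assms mem by fastforce
    show "S \<noteq> {}" using assms mem[of a] by auto
  qed
  ultimately show ?thesis by simp
qed

text \<open>The middle interval \<open>{x..x + M}\<close> is its own negative because the order is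
  \<open>2 * x + M\<close>. Sums of low elements stay below it by \<open>4 * a \<le> x + 1\<close>,
  and \<open>M < a\<close> keeps its own differences and its translates by low elements outside
  \<open>S\<close>. The gap from \<open>4 * a - 1\<close> to \<open>x - 1\<close> is either empty,
  or filled by middle minus low elements when \<open>M + 1 = a\<close> and
  \<open>x + 2 \<le> 6 * a\<close>.\<close>

lemma regular_sat_three_intervals:
  assumes "1 \<le> a" "4 * a \<le> x + 1" "M < a" "x + 1 = 4 * a \<or> (M + 1 = a \<and> x + 2 \<le> 6 * a)"
  shows "regular_sat 2 (2 * x + M) (2 * a + M + 1)"
proof -
  define N where "N = 2 * x + M"
  define S where "S = {a..<2 * a} \<union> {N + 1 - 2 * a..<N + 1 - a} \<union> {x..x + M}"
  have mem: "s \<in> S \<longleftrightarrow> (a \<le> s \<and> s < 2 * a) \<or> (N < s + 2 * a \<and> s + a \<le> N) \<or> (x \<le> s \<and> s \<le> x + M)" for s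
    using assms(1-3) by (auto simp: S_def N_def)
  have "card ({a..<2 * a} \<union> {N + 1 - 2 * a..<N + 1 - a}) = 2 * a"
    using assms(1-3) by (subst card_Un_disjoint) (auto simp: N_def)
  then have "card S = 2 * a + M + 1"
    unfolding S_def using assms(1-3) by (subst card_Un_disjoint) (auto simp: N_def)
  moreover have "regular_sat 2 N (card S)"
  proof (rule regular_sat_circulant)
    show "\<forall>t\<in>{1..N div 2} - S. \<exists>s\<in>S. t + s \<in> S \<or> (s < t \<and> t - s \<in> S)"
    proof
      fix t assume "t \<in> {1..N div 2} - S"
      then have t: "0 < t" "2 * t \<le> N" "t \<notin> S" by auto
      have "t < a \<or> 2 * a \<le> t" "t < x"
        using t assms(1-3) unfolding mem N_def by linarith+
      then consider "t < a" | "2 * a \<le> t" "t < 3 * a" | "3 * a \<le> t" "t < 4 * a - 1"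
        | "4 * a - 1 \<le> t" "t + a \<le> x" | "4 * a - 1 \<le> t" "x < t + a" by linarith
      then show "\<exists>s\<in>S. t + s \<in> S \<or> (s < t \<and> t - s \<in> S)"
      proof cases
        case 1
        then have "a \<in> S" "t + a \<in> S" using t assms(1-3) unfolding mem by linarith+
        then show ?thesis by blast
      next
        case 2
        then have "a \<in> S" "a < t" "t - a \<in> S" using assms(1-3) unfolding mem by linarith+
        then show ?thesis by blast
      next
        case 3
        then have "2 * a - 1 \<in> S" "2 * a - 1 < t" "t - (2 * a - 1) \<in> S"
          using assms(1-3) unfolding mem by linarith+
        then show ?thesis by blast
      next
        case 4
        then have "x - t \<in> S" "t + (x - t) \<in> S" using assms unfolding mem by linarith+
        then show ?thesis by blast
      next
        case 5
        then have "a \<in> S" "t + a \<in> S" using assms \<open>t < x\<close> unfolding mem by linarith+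
        then show ?thesis by blast
      qed
    qed
  next
    show "\<forall>s\<in>S. \<forall>t\<in>S. s + t \<notin> S"
    proof (intro ballI)
      fix s t assume "s \<in> S" "t \<in> S"
      then show "s + t \<notin> S" using assms(1-3) unfolding mem N_def by (elim disjE) linarith+
    qed
  next
    show "\<forall>s\<in>S. N - s \<in> S"
    proof
      fix s assume "s \<in> S"
      then show "N - s \<in> S" using assms(1-3) unfolding mem N_def by (elim disjE) linarith+
    qed
  next
    show "S \<subseteq> {1..<N}"
    proof
      fix s assume "s \<in> S"
      then show "s \<in> {1..<N}" using assms(1-3) unfolding mem N_def by auto
    qed
    show "S \<noteq> {}" using assms mem[of a] by auto
  qed
  ultimately show ?thesis by (simp add: N_def)
qed

text \<open>Found by computer search, for the orders \<open>61\<close>, \<open>71\<close>, \<open>91\<close> that the families miss for \<open>K\<^sub>4\<close>.\<close>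

lemma regular_sat_36_11: "regular_sat 2 36 11"
proof -
  have "regular_sat 2 36 (card ({1, 5, 8, 11, 15, 18, 21, 25, 28, 31, 35} :: nat set))"
    by (rule regular_sat_circulant; code_simp)
  then show ?thesis by (simp add: numeral_eq_Suc)
qed

lemma regular_sat_40_9: "regular_sat 2 40 9"
proof -
  have "regular_sat 2 40 (card ({1, 5, 9, 12, 20, 28, 31, 35, 39} :: nat set))"
    by (rule regular_sat_circulant; code_simp)
  then show ?thesis by (simp add: numeral_eq_Suc)
qed

lemma regular_sat_52_13: "regular_sat 2 52 13"
proof -
  have "regular_sat 2 52 (card ({15, 16, 17, 23, 24, 25, 26, 27, 28, 29, 35, 36, 37} :: nat set))"
    by (rule regular_sat_circulant; code_simp)
  then show ?thesis by (simp add: numeral_eq_Suc)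
qed

text \<open>Joining requires equal order minus degree, here \<open>c\<close> on both sides. The
  result has the same difference \<open>c\<close>, so the step can be repeated.\<close>

lemma regular_sat_join_empty:
  assumes "regular_sat r (d + c) d" "0 < c"
  shows "regular_sat (r + 1) (d + 2 * c) (d + c)"
  using regular_sat_join[OF assms(1) regular_sat_empty[OF assms(2)]] by (simp add: mult_2 add_ac)

section \<open>Orders attained for \<open>K_4\<close>\<close>

lemma regular_sat_3:
  fixes n :: nat
  assumes "59 < n"
  shows "\<exists>d. regular_sat 3 n d"
proof -
  have tri: ?thesis if "regular_sat 2 N d" "d < N" "n + d = 2 * N" for N d
  proof -
    have "regular_sat (2 + 1) (d + 2 * (N - d)) (d + (N - d))"
      by (rule regular_sat_join_empty) (use that in auto)
    moreover have "d + 2 * (N - d) = n" using that by linarith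
    ultimately show ?thesis by (auto simp del: One_nat_def)
  qed
  have two: ?thesis if "1 \<le> a" "5 * a \<le> m + 2" "m + 3 \<le> 7 * a" "n = 2 * m" for a m
  proof (rule tri)
    show "regular_sat 2 (m + a) (2 * a)" by (rule regular_sat_two_intervals) (use that in linarith)+
    show "2 * a < m + a" using that by linarith
    show "n + 2 * a = 2 * (m + a)" using that by simp
  qed
  have three: ?thesis if "1 \<le> a" "4 * a \<le> x + 1" "M < a" "x + 1 = 4 * a \<or> (M + 1 = a \<and> x + 2 \<le> 6 * a)"
      "n + 2 * a + 1 = 4 * x + M" for a x M
  proof (rule tri)
    show "regular_sat 2 (2 * x + M) (2 * a + M + 1)" by (rule regular_sat_three_intervals) (fact that)+
    show "2 * a + M + 1 < 2 * x + M" using that(1,2) by linarith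
    show "n + (2 * a + M + 1) = 2 * (2 * x + M)" using that(5) by simp
  qed
  \<comment> \<open>The case \<open>M = a - 1\<close> of \<open>three\<close>, with the bounds on
    \<open>x\<close> rewritten in terms of \<open>n\<close>. It forces \<open>n + a + 2\<close> to
    be divisible by 4, which for odd \<open>n\<close> ties \<open>a\<close> to \<open>n\<close>
    modulo 4.\<close>
  have full: ?thesis if "1 \<le> a" "n + a + 2 = 4 * x" "15 * a \<le> n + 6" "n + 10 \<le> 23 * a" for a x
    by (rule three[of a x "a - 1"]) (use that in arith)+
  \<comment> \<open>The case \<open>x = 4 * a - 1\<close> of \<open>three\<close>; its last equation
    determines \<open>M\<close>, and the bounds say \<open>0 \<le> M < a\<close>.\<close>
  have short: ?thesis if "1 \<le> a" "14 * a \<le> n + 5" "n + 5 < 15 * a" for a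
    by (rule three[of a "4 * a - 1" "n + 5 - 14 * a"]) (use that in arith)+
  \<comment> \<open>These are the balanced complete tripartite graphs.\<close>
  have turan: ?thesis if "n = 3 * c" for c
  proof -
    have "regular_sat 2 (2 * c) c"
      using regular_sat_join_empty[of 1 0 c] regular_sat_empty[of c] that assms by (simp add: numeral_2_eq_2)
    then show ?thesis by (rule tri) (use that assms in auto)
  qed
  consider "even n" | "n mod 4 = 1" | "n mod 4 = 3" by atomize_elim presburger
  then show ?thesis
  proof cases
    case 1
    then obtain m where "n = 2 * m" by blast
    \<comment> \<open>The witness is the largest \<open>a\<close> with
      \<open>5 * a \<le> m + 2\<close>.\<close>
    then show ?thesis using assms by (intro two[of "(m + 2) div 5" m]) arith+
  next
    case 2
    define y where "y = n div 4"
    have y: "n = 4 * y + 1" using 2 unfolding y_def by presburger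
    \<comment> \<open>Here \<open>full\<close> needs \<open>a\<close> congruent to 1 modulo 4:
      \<open>a = 5\<close> serves 69 to 105 and \<open>a = 9\<close> starts at 129. Other orders
      come from \<open>short\<close>, multiples of 3 and a sporadic graph.\<close>
    consider "n = 61"
      | "65 \<le> n" "n \<le> 68"
      | "17 \<le> y" "y \<le> 26"
      | "109 \<le> n" "n \<le> 114"
      | "n = 117"
      | "121 \<le> n" "n \<le> 128"
      | "32 \<le> y"
      using y assms by atomize_elim presburger
    then show ?thesis
    proof cases
      case 1
      then show ?thesis by (intro tri[OF regular_sat_36_11]) auto
    next
      case 2
      then show ?thesis by (intro short[of 5]) linarith+
    next
      case 3
      then show ?thesis using y by (intro full[of "5" "y + 2"]) arith+
    next
      case 4
      then show ?thesis by (intro short[of 8]) linarith+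
    next
      case 5
      then show ?thesis by (intro turan[of 39]) simp
    next
      case 6
      then show ?thesis by (intro short[of 9]) linarith+
    next
      case 7
      \<comment> \<open>\<open>4 * k + 1\<close> is the largest \<open>a\<close> congruent to 1
        modulo 4 with \<open>15 * a \<le> n + 6\<close>; the upper bound of \<open>full\<close> then
        follows from \<open>2 \<le> k\<close>.\<close>
      define k where "k = (n - 9) div 60"
      have k: "60 * k + 9 \<le> n" "n < 60 * k + 69" using 7 y unfolding k_def by linarith+
      then have "2 \<le> k" using 7 y by linarith
      with k have "60 * k + 15 \<le> n + 6" "n + 10 \<le> 92 * k + 23" by linarith+
      moreover have "n + (4 * k + 1) + 2 = 4 * (y + k + 1)" using y by simp
      ultimately show ?thesis by (intro full[of "4 * k + 1" "y + k + 1"]) simp_all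
    qed
  next
    case 3
    define y where "y = n div 4"
    have y: "n = 4 * y + 3" using 3 unfolding y_def by presburger
    \<comment> \<open>Now \<open>a\<close> is congruent to 3 modulo 4: \<open>a = 7\<close> serves
      99 to 151 and \<open>a = 11\<close> starts at 159.\<close>
    consider "n = 63"
      | "65 \<le> n" "n \<le> 69"
      | "n = 71"
      | "n = 75"
      | "79 \<le> n" "n \<le> 84"
      | "n = 87"
      | "n = 91"
      | "93 \<le> n" "n \<le> 98"
      | "24 \<le> y" "y \<le> 37"
      | "149 \<le> n" "n \<le> 158"
      | "39 \<le> y"
      using y assms by atomize_elim presburger
    then show ?thesis
    proof cases
      case 1
      then show ?thesis by (intro turan[of 21]) simp
    next
      case 2
      then show ?thesis by (intro short[of 5]) linarith+
    next
      case 3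
      then show ?thesis by (intro tri[OF regular_sat_40_9]) auto
    next
      case 4
      then show ?thesis by (intro turan[of 25]) simp
    next
      case 5
      then show ?thesis by (intro short[of 6]) linarith+
    next
      case 6
      then show ?thesis by (intro turan[of 29]) simp
    next
      case 7
      then show ?thesis by (intro tri[OF regular_sat_52_13]) auto
    next
      case 8
      then show ?thesis by (intro short[of 7]) linarith+
    next
      case 9
      then show ?thesis using y by (intro full[of "7" "y + 3"]) arith+
    next
      case 10
      then show ?thesis by (intro short[of 11]) linarith+
    next
      case 11
      define k where "k = (n - 39) div 60"
      have k: "60 * k + 39 \<le> n" "n < 60 * k + 99" using 11 y unfolding k_def by linarith+
      then have "2 \<le> k" using 11 y by linarith
      with k have "60 * k + 45 \<le> n + 6" "n + 10 \<le> 92 * k + 69" by linarith+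
      moreover have "n + (4 * k + 3) + 2 = 4 * (y + k + 2)" using y by simp
      ultimately show ?thesis by (intro full[of "4 * k + 3" "y + k + 2"]) simp_all
    qed
  qed
qed

section \<open>Orders attained for \<open>K_5\<close>\<close>

lemma regular_sat_4:
  fixes n :: nat
  assumes "59 < n"
  shows "\<exists>d. regular_sat 4 n d"
proof -
  have pair: ?thesis if "regular_sat 2 N d" "regular_sat 2 M e" "d + M = N + e" "n = N + M" for N d M e
    using regular_sat_join[OF that(1-3)] that(4) by auto
  have empties: ?thesis if a: "1 \<le> a" "4 * a \<le> c + 2" "c + 3 \<le> 6 * a" "n = 3 * c + 2 * a" for a c
  proof -
    have c: "0 < c" using a by linarith
    have "regular_sat 2 (c + 2 * a) (2 * a)"
      by (rule regular_sat_two_intervals) (use a in linarith)+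
    then have "regular_sat (2 + 1) (2 * a + c + c) (2 * a + c)"
      using regular_sat_join_empty[of 2 "2 * a" c] c by (simp add: add_ac mult_2)
    then have "regular_sat (2 + 1 + 1) (2 * a + c + 2 * c) (2 * a + c + c)"
      using c by (rule regular_sat_join_empty)
    moreover have "2 * a + c + 2 * c = n" using a(4) by simp
    ultimately show ?thesis by (auto simp del: One_nat_def)
  qed
  \<comment> \<open>Both graphs have order minus degree \<open>6 * e - 3\<close>: a two-interval
    graph with parameter \<open>a\<close>, and a three-interval graph with parameter
    \<open>e\<close> and \<open>x = 4 * e - 1\<close>. The last two bounds say
    \<open>0 \<le> M < e\<close>.\<close>
  have mixed: ?thesis if "1 \<le> e" "e \<le> a" "4 * a + 1 \<le> 6 * e" "14 * e + 2 * a \<le> n + 5" "n + 5 < 15 * e + 2 * a"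
    for e a
  proof (rule pair)
    define M where "M = n + 5 - (14 * e + 2 * a)"
    have M: "n + 5 = 14 * e + 2 * a + M" using that(4) by (simp add: M_def)
    show "regular_sat 2 (6 * e - 3 + 2 * a) (2 * a)"
      by (rule regular_sat_two_intervals) (use that in linarith)+
    show "regular_sat 2 (2 * (4 * e - 1) + M) (2 * e + M + 1)"
      by (rule regular_sat_three_intervals) (use that M in arith)+
    show "2 * a + (2 * (4 * e - 1) + M) = 6 * e - 3 + 2 * a + (2 * e + M + 1)"
      "n = 6 * e - 3 + 2 * a + (2 * (4 * e - 1) + M)"
      using that M by arith+
  qed
  consider "even n" | "odd n" by blast
  then show ?thesis
  proof cases
    case 1
    then obtain N where N: "n = 2 * N" by blast
    \<comment> \<open>A graph joined to a copy of itself meets the degree condition trivially; the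
      parameter is the largest allowed by \<open>6 * a \<le> N + 2\<close>.\<close>
    have "regular_sat 2 N (2 * ((N + 2) div 6))"
      by (rule regular_sat_two_intervals) (use N assms in linarith)+
    from pair[OF this this] N show ?thesis by simp
  next
    case 2
    then obtain y where y: "n = 2 * y + 1" by (rule oddE)
    consider "61 \<le> n" "n \<le> 64"
      | "n = 65"
      | "n = 67"
      | "n = 69"
      | "n = 71"
      | "n = 73"
      | "75 \<le> n" "n \<le> 79"
      | "79 \<le> n" "n \<le> 83"
      | "n = 85"
      | "n = 87"
      | "n = 89"
      | "91 \<le> n" "n \<le> 96"
      | "95 \<le> n" "n \<le> 100"
      | "n = 101"
      | "n = 103"
      | "n = 105"
      | "107 \<le> n" "n \<le> 113"
      | "113 \<le> n" "n \<le> 119"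
      | "n = 121"
      | "123 \<le> n" "n \<le> 130"
      | "129 \<le> n" "n \<le> 136"
      | "134 \<le> n"
      using y assms by atomize_elim presburger
    then show ?thesis
    proof cases
      case 1
      then show ?thesis by (intro mixed[of 4 5]) linarith+
    next
      case 2
      then show ?thesis by (intro empties[of 4 19]) simp_all
    next
      case 3
      then show ?thesis by (intro empties[of 5 19]) simp_all
    next
      case 4
      then show ?thesis using regular_sat_two_intervals[of 5 35] regular_sat_three_intervals[of 3 16 2] pair by simp
    next
      case 5
      then show ?thesis by (intro empties[of 4 21]) simp_all
    next
      case 6
      then show ?thesis by (intro empties[of 5 21]) simp_all
    next
      case 7
      then show ?thesis by (intro mixed[of 5 5]) linarith+
    next
      case 8
      then show ?thesis by (intro mixed[of 5 7]) linarith+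
    next
      case 9
      then show ?thesis by (intro empties[of 5 25]) simp_all
    next
      case 10
      then show ?thesis by (intro empties[of 6 25]) simp_all
    next
      case 11
      then show ?thesis using regular_sat_two_intervals[of 6 43] regular_sat_three_intervals[of 5 21 4] pair by simp
    next
      case 12
      then show ?thesis by (intro mixed[of 6 6]) linarith+
    next
      case 13
      then show ?thesis by (intro mixed[of 6 8]) linarith+
    next
      case 14
      then show ?thesis by (intro empties[of 7 29]) simp_all
    next
      case 15
      then show ?thesis using regular_sat_two_intervals[of 9 53] regular_sat_three_intervals[of 5 23 4] pair by simp
    next
      case 16
      then show ?thesis by (intro empties[of 6 31]) simp_all
    next
      case 17
      then show ?thesis by (intro mixed[of 7 7]) linarith+
    next
      case 18
      then show ?thesis by (intro mixed[of 7 10]) linarith+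
    next
      case 19
      then show ?thesis by (intro empties[of 8 35]) simp_all
    next
      case 20
      then show ?thesis by (intro mixed[of 8 8]) linarith+
    next
      case 21
      then show ?thesis by (intro mixed[of 8 11]) linarith+
    next
      case 22
      \<comment> \<open>Eliminating \<open>c\<close> from \<open>n = 3 * c + 2 * a\<close> turns the
        bounds of \<open>empties\<close> into \<open>14 * a \<le> n + 6\<close> and
        \<open>n + 9 \<le> 20 * a\<close>. So \<open>q\<close> is the largest candidate, and
        \<open>a\<close> is the largest value up to \<open>q\<close> with \<open>a + n\<close>
        divisible by 3, which makes \<open>c = t - a\<close> integral. Rounding down loses at most
        2, and the second bound survives once \<open>8 \<le> a\<close>, hence the threshold
        134.\<close>
      define q where "q = (n + 6) div 14"
      define a where "a = q - (q + n) mod 3"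
      define t where "t = (q + n) div 3"
      have q: "14 * q \<le> n + 6" "n + 6 < 14 * q + 14" unfolding q_def by linarith+
      have "(q + n) mod 3 < 3" by simp
      then have a: "a \<le> q" "q \<le> a + 2" "q = a + (q + n) mod 3" using q 22 unfolding a_def by linarith+
      have "q + n = 3 * t + (q + n) mod 3" unfolding t_def by simp
      then have t: "a + n = 3 * t" using a(3) by linarith
      have "10 \<le> q" using q 22 by linarith
      then have "8 \<le> a" using a by linarith
      have "n = 3 * (t - a) + 2 * a" using a t q by linarith
      then show ?thesis using \<open>8 \<le> a\<close> a q 22 by (intro empties[of a "t - a"]) linarith+
    qed
  qed
qed

theorem theorem1p1:
  fixes n :: nat
  assumes "n > 59"
  shows "(\<exists>G :: nat pair_pre_digraph.
            pair_graph G \<and> card (pverts G) = n \<and> regular_graph G \<and> saturated (complete_graph 4) G) \<and>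
         (\<exists>G :: nat pair_pre_digraph.
            pair_graph G \<and> card (pverts G) = n \<and> regular_graph G \<and> saturated (complete_graph 5) G)"
proof -
  obtain d e where "regular_sat 3 n d" "regular_sat 4 n e"
    using regular_sat_3 regular_sat_4 assms by blast
  from this[THEN regular_sat_imp_saturated_graph] show ?thesis by simp
qed

end
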